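(* Let $f:X\to Y$ be a continuous surjective map between Tychonoff spaces $X$ and $Y$. Then $f$ is a weakly $\kappa$-pseudo open map if, and only if, for every open non-closed set $U\subseteq Y$ there is $y\in\overline{U}\setminus U$ such that $f^{-1}(y)\cap\overline{f^{-1}(U)}\neq\emptyset$. Consequently, each (continuous surjective) $\kappa$-pseudo open map is a weakly $\kappa$-pseudo open map.
   Context: All topological spaces are assumed to be Tychonoff. A surjective continuous map $f:X\to Y$ is called weakly $\kappa$-pseudo open if an open set $U\subseteq Y$ is closed in $Y$ if and only if $f^{-1}(U)$ is closed in $X$. A map $f:X\to Y$ is called $\kappa$-pseudo open if whenever $y\in Y$, $U$ is open in $X$ and $f^{-1}(y)\subseteq U$, then $y\in\operatorname{Int}\big(\overline{f(U)}\big)$. *)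

theory Defs
  imports "HOL-Analysis.Analysis"
begin

definition Tychonoff_space :: "'a topology \<Rightarrow> bool"
  where "Tychonoff_space X \<longleftrightarrow> completely_regular_space X \<and> t1_space X"

text \<open>Spaces carry an explicit \<^term>\<open>topspace X\<close>, so preimages and fibres are taken relative to it.\<close>

definition weakly_kappa_pseudo_open_map ::
    "'a topology \<Rightarrow> 'b topology \<Rightarrow> ('a \<Rightarrow> 'b) \<Rightarrow> bool"
  where "weakly_kappa_pseudo_open_map X Y f \<longleftrightarrow>
    continuous_map X Y f \<and> f ` topspace X = topspace Y \<and>
    (\<forall>U. openin Y U \<longrightarrow> (closedin Y U \<longleftrightarrow> closedin X {x \<in> topspace X. f x \<in> U}))"

text \<open>Continuity and surjectivity are not part of the following notion.\<close>

definition kappa_pseudo_open_map ::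
    "'a topology \<Rightarrow> 'b topology \<Rightarrow> ('a \<Rightarrow> 'b) \<Rightarrow> bool"
  where "kappa_pseudo_open_map X Y f \<longleftrightarrow>
    f \<in> topspace X \<rightarrow> topspace Y \<and>
    (\<forall>y U. y \<in> topspace Y \<and> openin X U \<and> {x \<in> topspace X. f x = y} \<subseteq> U
       \<longrightarrow> y \<in> Y interior_of (Y closure_of (f ` U)))"

end

theory Submission
  imports Defs
begin

text \<open>Continuity makes preimages of closed sets closed, so being weakly kappa-pseudo open only
  demands that an open non-closed \<open>U\<close> have a non-closed preimage. That preimage fails
  to be closed exactly when its closure contains a point outside it, and \<open>f\<close> sends such
  a point into the closure of \<open>U\<close> but not into \<open>U\<close>; this gives the
  criterion (\<open>not_closedin_preimage_iff\<close>). For kappa-pseudo open maps, the defining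
  condition is applied to the complement of a closed preimage
  (\<open>kappa_pseudo_open_map_closedin\<close>).\<close>

lemma not_closedin_preimage_iff:
  assumes "continuous_map X Y f" and "U \<subseteq> topspace Y"
  shows "\<not> closedin X {x \<in> topspace X. f x \<in> U} \<longleftrightarrow>
    (\<exists>y \<in> (Y closure_of U) - U.
       {x \<in> topspace X. f x = y} \<inter> (X closure_of {x \<in> topspace X. f x \<in> U}) \<noteq> {})"
    (is "\<not> closedin X ?P \<longleftrightarrow> _")
proof -
  have "\<not> closedin X ?P \<longleftrightarrow> \<not> X closure_of ?P \<subseteq> ?P"
    by (auto simp flip: closure_of_subset_eq)
  moreover have "f x \<in> Y closure_of U" if "x \<in> X closure_of ?P" for x
    using continuous_map_image_closure_subset[OF assms(1), of ?P] that
      closure_of_mono[of "f ` ?P" U Y] by blast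
  \<comment> \<open>A point \<open>x\<close> of the closure outside \<open>?P\<close> yields the
    witness \<open>y = f x\<close>; conversely, a point of the fibre over \<open>y\<close> lies
    outside \<open>?P\<close> because \<open>y\<close> is not in \<open>U\<close>.\<close>
  ultimately show ?thesis
    using closure_of_subset_topspace[of X ?P] by blast
qed

lemma kappa_pseudo_open_map_closedin:
  assumes "kappa_pseudo_open_map X Y f" and "openin Y U"
    and "closedin X {x \<in> topspace X. f x \<in> U}"
  shows "closedin Y U"
proof -
  define V where "V = topspace X - {x \<in> topspace X. f x \<in> U}"
  have V: "openin X V"
    using assms(3) by (simp add: V_def openin_diff)
  have "f ` V \<subseteq> topspace Y - U"
    using assms(1) by (auto simp: V_def kappa_pseudo_open_map_def)
  \<comment> \<open>Openness of \<open>U\<close> enters here: its complement is closed.\<close>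
  then have "Y closure_of (f ` V) \<subseteq> topspace Y - U"
    by (simp add: closure_of_minimal closedin_diff assms(2))
  then have int: "Y interior_of (Y closure_of (f ` V)) \<subseteq> topspace Y - Y closure_of U"
    using interior_of_mono[of _ "topspace Y - U" Y] by (simp add: interior_of_complement)
  have "y \<in> U" if y: "y \<in> Y closure_of U" for y
  proof (rule ccontr)
    assume "y \<notin> U"
    then have "{x \<in> topspace X. f x = y} \<subseteq> V"
      by (auto simp: V_def)
    then have "y \<in> Y interior_of (Y closure_of (f ` V))"
      using assms(1) V y in_closure_of[of y Y U] by (auto simp: kappa_pseudo_open_map_def)
    then show False
      using int y by blast
  qed
  then show ?thesis
    using closure_of_subset_eq[of U Y] openin_subset[OF assms(2)] by blast
qed

lemma weakly_kappa_pseudo_open_map_iff: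
  assumes "continuous_map X Y f" and "f ` topspace X = topspace Y"
  shows "weakly_kappa_pseudo_open_map X Y f \<longleftrightarrow>
    (\<forall>U. openin Y U \<and> closedin X {x \<in> topspace X. f x \<in> U} \<longrightarrow> closedin Y U)"
  using assms closedin_continuous_map_preimage[OF assms(1)]
  unfolding weakly_kappa_pseudo_open_map_def by blast

theorem lemma4p3:
  fixes X :: "'a topology" and Y :: "'b topology" and f :: "'a \<Rightarrow> 'b"
  assumes "Tychonoff_space X" and "Tychonoff_space Y"
    and "continuous_map X Y f" and "f ` topspace X = topspace Y"
  shows "(weakly_kappa_pseudo_open_map X Y f \<longleftrightarrow>
           (\<forall>U. openin Y U \<and> \<not> closedin Y U \<longrightarrow>
              (\<exists>y \<in> (Y closure_of U) - U.
                 {x \<in> topspace X. f x = y} \<inter> (X closure_of {x \<in> topspace X. f x \<in> U}) \<noteq> {})))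
         \<and> (kappa_pseudo_open_map X Y f \<longrightarrow> weakly_kappa_pseudo_open_map X Y f)"
proof
  show "weakly_kappa_pseudo_open_map X Y f \<longleftrightarrow>
           (\<forall>U. openin Y U \<and> \<not> closedin Y U \<longrightarrow>
              (\<exists>y \<in> (Y closure_of U) - U.
                 {x \<in> topspace X. f x = y} \<inter> (X closure_of {x \<in> topspace X. f x \<in> U}) \<noteq> {}))"
    unfolding weakly_kappa_pseudo_open_map_iff[OF assms(3,4)]
  proof (rule iff_allI, goal_cases)
    case (1 U)
    then show ?case
      \<comment> \<open>For each fixed \<open>U\<close>, the two sides are contrapositives of each
        other.\<close>
      using not_closedin_preimage_iff[OF assms(3) openin_subset, of U] by argo
  qed
  show "kappa_pseudo_open_map X Y f \<longrightarrow> weakly_kappa_pseudo_open_map X Y f"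
    unfolding weakly_kappa_pseudo_open_map_iff[OF assms(3,4)]
    using kappa_pseudo_open_map_closedin by blast
qed

end
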